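(* Let $n\ge 1$, let $\mathcal T=(T_1,\dots,T_n)$ be any tree sequence of order $n$, and let $\mathbf k=(k_1,\dots,k_n)\in\mathbb Z^n$. Then the signed enumeration of Gelfand–Tsetlin tree sequences associated with $\mathcal T$ and $\mathbf k$ is $$L_n(\mathcal T,\mathbf k)=\prod_{1\le i<j\le n}\frac{k_j-k_i+j-i}{j-i}.$$
   Context: An $n$-tree is a directed tree (every edge has an orientation) whose vertex set is $\{1,2,\dots,n\}$ and whose $n-1$ edges are named bijectively by the primed symbols $1',2',\dots,(n-1)'$. A tree sequence of order $n$ is a sequence $\mathcal T=(T_1,\dots,T_n)$ where $T_i$ is an $i$-tree for each $i$. Admissibility: let $T$ be an $n$-tree and $\mathbf k=(k_1,\dots,k_n)\in\mathbb Z^n$. A vector $\mathbf l=(l_1,\dots,l_{n-1})\in\mathbb Z^{n-1}$ is admissible for $(T,\mathbf k)$ if for every edge $j'$ of $T$, directed from vertex $p$ to vertex $q$: if $k_p+p<k_q+q$ then $k_p+p\le l_j+j<k_q+q$, and otherwise $k_q+q\le l_j+j<k_p+p$; in the latter case the edge $j'$ is called an inversion of $(T,\mathbf k)$. (So no admissible vector exists if some edge has $k_p+p=k_q+q$.) Gelfand–Tsetlin tree sequences: given a tree sequence $\mathcal T=(T_1,\dots,T_n)$ and $\mathbf k\in\mathbb Z^n$, a Gelfand–Tsetlin tree sequence is a sequence $\mathbf L=(\mathbf l_1,\dots,\mathbf l_n)$ with $\mathbf l_i\in\mathbb Z^i$, $\mathbf l_n=\mathbf k$, such that $\mathbf l_{i-1}$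 is admissible for $(T_i,\mathbf l_i)$ for $i=2,\dots,n$. Its inversions are the inversions of the pairs $(T_i,\mathbf l_i)$, $i=2,\dots,n$. Sign of an $n$-tree $T$: choose a root vertex $r$; the standard orientation orients every edge away from $r$; an edge is reversed if its orientation in $T$ differs from the standard one. Every non-root vertex is the head (w.r.t. the standard orientation) of exactly one edge; let $\pi$ be the permutation of $\{1,\dots,n\}$ given by $r$ followed by the heads of the edges $1',2',\dots,(n-1)'$ in this order. Then $\operatorname{sgn}T=(-1)^{\#\text{reversed edges}}\operatorname{sgn}\pi$ (this does not depend on the root). The sign of a tree sequence is $\operatorname{sgn}\mathcal T=\prod_{i=1}^n\operatorname{sgn}T_i$. The sign of a Gelfand–Tsetlin tree sequence $\mathbf L$ is $(-1)^{\#\text{inversions of }\mathbf L}\operatorname{sgn}\mathcal T$, and $L_n(\mathcal T,\mathbf k)$ denotes the sum of the signs of all Gelfand–Tsetlin tree sequences associated with $\mathcal T$ and $\mathbf k$. *)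

theory Defs
  imports
    "Graph_Theory.Digraph_Component"
    "HOL-Combinatorics.Permutations"
    "HOL-Library.FuncSet"
begin

text \<open>
  The edge named \<open>j'\<close> is represented by the number \<open>j\<close>. A vector in \<open>\<int>\<^sup>i\<close> is a function on
  \<open>{1..i}\<close>; where vectors are counted, it is taken to be extensional.
\<close>

text \<open>
  Every edge can be traversed in both directions, the flag telling whether the orientation
  is respected. Walks in this digraph are the undirected walks of the given one, with edge names
  retained (in contrast to the library's \<open>mk_symmetric\<close>).
\<close>

definition both_ways :: "('a, 'b) pre_digraph \<Rightarrow> ('a, 'b \<times> bool) pre_digraph" where
  "both_ways G =
     \<lparr> verts = verts G, arcs = arcs G \<times> UNIV,
       tail = (\<lambda>(e, fwd). if fwd then tail G e else head G e),
       head = (\<lambda>(e, fwd). if fwd then head G e else tail G e) \<rparr>"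

text \<open>
  The library's \<open>tree\<close> only excludes directed cycles, so it cannot be used here. The
  distinctness condition below rules out running through one and the same edge back and forth.
\<close>

definition undirected_acyclic :: "('a, 'b) pre_digraph \<Rightarrow> bool" where
  "undirected_acyclic G \<longleftrightarrow>
     \<not> (\<exists>p. pre_digraph.cycle (both_ways G) p \<and> distinct (map fst p))"

definition n_tree :: "nat \<Rightarrow> (nat, nat) pre_digraph \<Rightarrow> bool" where
  "n_tree n T \<longleftrightarrow>
     wf_digraph T \<and> verts T = {1..n} \<and> arcs T = {1..<n} \<and>
     connected T \<and> undirected_acyclic T"

definition tree_sequence :: "nat \<Rightarrow> (nat \<Rightarrow> (nat, nat) pre_digraph) \<Rightarrow> bool" where
  "tree_sequence n T \<longleftrightarrow> (\<forall>i\<in>{1..n}. n_tree i (T i))"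

text \<open>
  The head of \<open>e\<close> in the standard orientation with respect to the root \<open>r\<close> is the endpoint
  of the path that starts in \<open>r\<close> and has \<open>e\<close> as its last edge.
\<close>

definition std_head :: "('a, 'b) pre_digraph \<Rightarrow> 'a \<Rightarrow> 'b \<Rightarrow> 'a" where
  "std_head T r e = (THE v. \<exists>p fwd. pre_digraph.apath (both_ways T) r (p @ [(e, fwd)]) v)"

definition reversed_edges :: "('a, 'b) pre_digraph \<Rightarrow> 'a \<Rightarrow> 'b set" where
  "reversed_edges T r = {e \<in> arcs T. head T e \<noteq> std_head T r e}"

definition head_perm :: "nat \<Rightarrow> (nat, nat) pre_digraph \<Rightarrow> nat \<Rightarrow> nat \<Rightarrow> nat" where
  "head_perm n T r m =
     (if m = 1 then r else if m \<in> {2..n} then std_head T r (m - 1) else m)"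

definition rooted_tree_sign :: "nat \<Rightarrow> (nat, nat) pre_digraph \<Rightarrow> nat \<Rightarrow> int" where
  "rooted_tree_sign n T r = (-1) ^ card (reversed_edges T r) * sign (head_perm n T r)"

definition tree_sign :: "nat \<Rightarrow> (nat, nat) pre_digraph \<Rightarrow> int" where
  "tree_sign n T = rooted_tree_sign n T (SOME r. r \<in> {1..n})"

definition tree_sequence_sign :: "nat \<Rightarrow> (nat \<Rightarrow> (nat, nat) pre_digraph) \<Rightarrow> int" where
  "tree_sequence_sign n T = (\<Prod>i\<in>{1..n}. tree_sign i (T i))"

definition admissible ::
    "(nat, nat) pre_digraph \<Rightarrow> (nat \<Rightarrow> int) \<Rightarrow> (nat \<Rightarrow> int) \<Rightarrow> bool" where
  "admissible T k l \<longleftrightarrow>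
     (\<forall>j\<in>arcs T. let p = tail T j; q = head T j in
        if k p + int p < k q + int q
        then k p + int p \<le> l j + int j \<and> l j + int j < k q + int q
        else k q + int q \<le> l j + int j \<and> l j + int j < k p + int p)"

definition inversions :: "(nat, nat) pre_digraph \<Rightarrow> (nat \<Rightarrow> int) \<Rightarrow> nat set" where
  "inversions T k =
     {j \<in> arcs T. \<not> k (tail T j) + int (tail T j) < k (head T j) + int (head T j)}"

definition GT_tree_sequences ::
    "nat \<Rightarrow> (nat \<Rightarrow> (nat, nat) pre_digraph) \<Rightarrow> (nat \<Rightarrow> int) \<Rightarrow> (nat \<Rightarrow> nat \<Rightarrow> int) set" where
  "GT_tree_sequences n T k =
     {L \<in> (\<Pi>\<^sub>E i\<in>{1..n}. {1..i} \<rightarrow>\<^sub>E UNIV).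
        (\<forall>j\<in>{1..n}. L n j = k j) \<and>
        (\<forall>i\<in>{2..n}. admissible (T i) (L i) (L (i - 1)))}"

definition GT_inversions ::
    "nat \<Rightarrow> (nat \<Rightarrow> (nat, nat) pre_digraph) \<Rightarrow> (nat \<Rightarrow> nat \<Rightarrow> int) \<Rightarrow> (nat \<times> nat) set" where
  "GT_inversions n T L = (SIGMA i:{2..n}. inversions (T i) (L i))"

definition GT_sign ::
    "nat \<Rightarrow> (nat \<Rightarrow> (nat, nat) pre_digraph) \<Rightarrow> (nat \<Rightarrow> nat \<Rightarrow> int) \<Rightarrow> int" where
  "GT_sign n T L = (-1) ^ card (GT_inversions n T L) * tree_sequence_sign n T"

definition signed_GT_enumeration ::
    "nat \<Rightarrow> (nat \<Rightarrow> (nat, nat) pre_digraph) \<Rightarrow> (nat \<Rightarrow> int) \<Rightarrow> int" where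
  "signed_GT_enumeration n T k = (\<Sum>L\<in>GT_tree_sequences n T k. GT_sign n T L)"

end

theory Submission
  imports Defs "Jordan_Normal_Form.Determinant"
begin

text \<open>
  Put \<open>x\<^sub>i = k\<^sub>i + i\<close>. Up to a Vandermonde argument, the right-hand side is the determinant of the
  matrix of binomial coefficients \<open>x\<^sub>i gchoose j\<close> with \<open>0 \<le> j < n\<close>, and one shows by induction on
  \<open>n\<close> that the signed enumeration equals this determinant. Summing the determinant of order
  \<open>n - 1\<close> over all admissible vectors, with the inversion sign, works row by row: the row of an edge
  from \<open>p\<close> to \<open>q\<close> telescopes to the difference of the rows of \<open>q\<close> and \<open>p\<close> in the matrix of order
  \<open>n\<close>. Hence the result is the determinant of order \<open>n\<close> multiplied by the determinant of the
  incidence matrix of the tree, completed by the unit row of the root. In the Leibniz expansion of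
  the latter only one term survives, and it is the sign of the tree; so the two tree signs cancel.
\<close>

subsection \<open>Vandermonde determinants of binomial coefficients\<close>

text \<open>Evaluating polynomials is multiplying the Vandermonde matrix by the matrix of their
  coefficients. The degree bound makes the coefficient matrix upper triangular, so its determinant
  is the product of the entries \<open>coeff (p j) j\<close>.\<close>

lemma det_poly_eval:
  fixes x :: "nat \<Rightarrow> 'a::comm_ring_1"
  assumes deg: "\<And>j. j < n \<Longrightarrow> degree (p j) \<le> j"
  shows "det (mat n n (\<lambda>(i, j). poly (p j) (x i))) =
    (\<Prod>j<n. coeff (p j) j) * det (mat n n (\<lambda>(i, j). x i ^ j))"
proof -
  let ?V = "mat n n (\<lambda>(i, j). x i ^ j)"
  let ?U = "mat n n (\<lambda>(k, j). coeff (p j) k)"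
  have "mat n n (\<lambda>(i, j). poly (p j) (x i)) = ?V * ?U"
  proof (rule eq_matI)
    fix i j assume "i < dim_row (?V * ?U)" and "j < dim_col (?V * ?U)"
    then have ij: "i < n" "j < n" by auto
    have "poly (p j) (x i) = (\<Sum>k\<le>degree (p j). coeff (p j) k * x i ^ k)"
      by (rule poly_altdef)
    also have "\<dots> = (\<Sum>k<n. coeff (p j) k * x i ^ k)"
      using deg[OF ij(2)] ij(2)
      by (intro sum.mono_neutral_left) (auto simp: coeff_eq_0)
    finally show "mat n n (\<lambda>(i, j). poly (p j) (x i)) $$ (i, j) = (?V * ?U) $$ (i, j)"
      using ij by (simp add: scalar_prod_def lessThan_atLeast0 mult.commute)
  qed auto
  moreover have "det ?U = (\<Prod>j<n. coeff (p j) j)"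
  proof -
    have "upper_triangular ?U"
      unfolding upper_triangular_def
    proof (intro allI impI)
      fix i j assume "i < dim_row ?U" and "j < i"
      then show "?U $$ (i, j) = 0"
        using deg[of j] by (simp add: coeff_eq_0)
    qed
    then have "det ?U = prod_list (diag_mat ?U)"
      by (rule det_upper_triangular[of _ n]) simp
    then show ?thesis
      by (simp add: prod_list_diag_prod lessThan_atLeast0)
  qed
  ultimately show ?thesis
    by (simp add: det_mult[of _ n] mult.commute)
qed

lemma det_last_column:
  fixes A :: "'a::comm_ring_1 mat"
  assumes A: "A \<in> carrier_mat (Suc n) (Suc n)"
    and zero: "\<And>i. i < n \<Longrightarrow> A $$ (i, n) = 0"
  shows "det A = A $$ (n, n) * det (mat n n (\<lambda>(i, j). A $$ (i, j)))"
proof -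
  have "det A = (\<Sum>i<Suc n. A $$ (i, n) * cofactor A i n)"
    using A by (rule laplace_expansion_column) simp
  also have "\<dots> = A $$ (n, n) * det (mat_delete A n n)"
    using zero by (simp add: cofactor_def)
  also have "mat_delete A n n = mat n n (\<lambda>(i, j). A $$ (i, j))"
    using A by (intro eq_matI) (auto simp: mat_delete_def)
  finally show ?thesis .
qed

lemma det_first_column:
  fixes A :: "'a::comm_ring_1 mat"
  assumes A: "A \<in> carrier_mat (Suc n) (Suc n)"
    and zero: "\<And>i. i < n \<Longrightarrow> A $$ (Suc i, 0) = 0"
  shows "det A = A $$ (0, 0) * det (mat n n (\<lambda>(i, j). A $$ (Suc i, Suc j)))"
proof -
  have "det A = (\<Sum>i<Suc n. A $$ (i, 0) * cofactor A i 0)"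
    using A by (rule laplace_expansion_column) simp
  also have "\<dots> = A $$ (0, 0) * det (mat_delete A 0 0)"
    using zero by (simp add: sum.lessThan_Suc_shift cofactor_def del: sum.lessThan_Suc)
  also have "mat_delete A 0 0 = mat n n (\<lambda>(i, j). A $$ (Suc i, Suc j))"
    using A by (intro eq_matI) (auto simp: mat_delete_def)
  finally show ?thesis .
qed

lemma
  fixes x :: "nat \<Rightarrow> 'a::comm_ring_1"
  shows degree_prod_monic_linear: "degree (\<Prod>i<n. [:- x i, 1:]) \<le> n"
    and coeff_prod_monic_linear: "coeff (\<Prod>i<n. [:- x i, 1:]) n = 1"
proof (induction n)
  case (Suc n)
  let ?q = "\<Prod>i<n. [:- x i, 1:]"
  have "degree (?q * [:- x n, 1:]) \<le> n + 1"
    using Suc.IH(1) by (intro order.trans[OF degree_mult_le]) auto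
  then show "degree (\<Prod>i<Suc n. [:- x i, 1:]) \<le> Suc n"
    by simp
  \<comment> \<open>Multiplying by \<open>[:- x n, 1:]\<close> gives
    \<open>coeff ?q n - x n * coeff ?q (Suc n)\<close> in position \<open>Suc n\<close>; the degree
    bound removes the second term.\<close>
  have "coeff ?q (Suc n) = 0"
    using Suc.IH(1) by (intro coeff_eq_0) auto
  then show "coeff (\<Prod>i<Suc n. [:- x i, 1:]) (Suc n) = 1"
    using Suc.IH(2) by (simp add: mult.commute)
qed auto

text \<open>By \<open>det_poly_eval\<close> the determinant is unchanged when the monomial of the
  last column gives way to the monic polynomial with roots \<open>x 0, ..., x (n - 1)\<close>. That
  column then vanishes except at the bottom, and an expansion along it leaves the case
  \<open>n\<close>.\<close>

lemma det_vandermonde: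
  fixes x :: "nat \<Rightarrow> 'a::comm_ring_1"
  shows "det (mat n n (\<lambda>(i, j). x i ^ j)) = (\<Prod>j<n. \<Prod>i<j. x j - x i)"
proof (induction n)
  case 0
  show ?case by simp
next
  case (Suc n)
  define q where "q = (\<Prod>i<n. [:- x i, 1:])"
  have q: "degree q \<le> n" "coeff q n = 1"
    by (simp_all add: q_def degree_prod_monic_linear coeff_prod_monic_linear)
  define p where "p j = (if j = n then q else monom 1 j)" for j
  let ?A = "mat (Suc n) (Suc n) (\<lambda>(i, j). poly (p j) (x i))"
  have "det ?A = (\<Prod>j<Suc n. coeff (p j) j) * det (mat (Suc n) (Suc n) (\<lambda>(i, j). x i ^ j))"
    using q by (intro det_poly_eval) (auto simp: p_def degree_monom_le)
  then have "det (mat (Suc n) (Suc n) (\<lambda>(i, j). x i ^ j)) = det ?A"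
    using q by (simp add: p_def)
  also have "\<dots> = ?A $$ (n, n) * det (mat n n (\<lambda>(i, j). ?A $$ (i, j)))"
    by (rule det_last_column) (auto simp: p_def q_def poly_prod intro!: prod_zero)
  also have "mat n n (\<lambda>(i, j). ?A $$ (i, j)) = mat n n (\<lambda>(i, j). x i ^ j)"
    by (intro eq_matI) (auto simp: p_def poly_monom)
  also have "?A $$ (n, n) = (\<Prod>i<n. x n - x i)"
    by (simp add: p_def q_def poly_prod)
  finally show ?case
    using Suc.IH by (simp add: mult.commute)
qed

text \<open>Matrix indices start at 0 and vector indices at 1, hence \<open>x (Suc i)\<close> in row
  \<open>i\<close>. Binomial coefficients serve better than powers because Pascal's rule makes their
  sums telescope.\<close>

definition binomial_mat :: "nat \<Rightarrow> (nat \<Rightarrow> 'a::field_char_0) \<Rightarrow> 'a mat" where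
  "binomial_mat n x = mat n n (\<lambda>(i, j). x (Suc i) gchoose j)"

lemma binomial_mat_carrier [simp]: "binomial_mat n x \<in> carrier_mat n n"
  by (simp add: binomial_mat_def)

text \<open>As a polynomial in \<open>x\<close>, \<open>x gchoose j\<close> has degree
  \<open>j\<close> and leading coefficient \<open>1 / fact j\<close>. Writing \<open>fact j\<close>
  as the product of \<open>j - i\<close> over \<open>i < j\<close> spreads the denominators over the
  Vandermonde factors.\<close>

lemma det_binomial_mat:
  fixes x :: "nat \<Rightarrow> 'a::field_char_0"
  shows "det (binomial_mat n x) =
    (\<Prod>j<n. \<Prod>i<j. (x (Suc j) - x (Suc i)) / (of_nat j - of_nat i))"
proof -
  define p :: "nat \<Rightarrow> 'a poly"
    where "p j = smult (inverse (fact j)) (\<Prod>i<j. [:- of_nat i, 1:])" for j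
  have p: "degree (p j) \<le> j" "coeff (p j) j = inverse (fact j)" for j
    using degree_prod_monic_linear[of "of_nat :: nat \<Rightarrow> 'a" j]
      coeff_prod_monic_linear[of "of_nat :: nat \<Rightarrow> 'a" j]
    by (simp_all add: p_def)
  have "binomial_mat n x = mat n n (\<lambda>(i, j). poly (p j) (x (Suc i)))"
    unfolding binomial_mat_def
    by (intro eq_matI)
      (auto simp: p_def poly_prod gbinomial_prod_rev lessThan_atLeast0 field_simps)
  then have "det (binomial_mat n x) =
      (\<Prod>j<n. inverse (fact j)) * (\<Prod>j<n. \<Prod>i<j. x (Suc j) - x (Suc i))"
    using det_poly_eval[of n p "\<lambda>i. x (Suc i)"] p by (simp add: det_vandermonde)
  also have "\<dots> = (\<Prod>j<n. (\<Prod>i<j. x (Suc j) - x (Suc i)) / fact j)"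
    by (simp add: prod.distrib[symmetric] divide_inverse mult.commute)
  also have "\<dots> = (\<Prod>j<n. \<Prod>i<j. (x (Suc j) - x (Suc i)) / (of_nat j - of_nat i))"
  proof (intro prod.cong refl)
    fix j
    have "fact j = (\<Prod>i<j. of_nat (j - i) :: 'a)"
      by (simp add: fact_prod_rev lessThan_atLeast0)
    also have "\<dots> = (\<Prod>i<j. of_nat j - of_nat i)"
      by (intro prod.cong) (auto simp: of_nat_diff)
    finally show "(\<Prod>i<j. x (Suc j) - x (Suc i)) / fact j =
        (\<Prod>i<j. (x (Suc j) - x (Suc i)) / (of_nat j - of_nat i))"
      by (simp add: prod_dividef)
  qed
  finally show ?thesis .
qed

subsection \<open>Standard heads in a rooted tree\<close>

lemma wf_digraph_both_ways:
  assumes "wf_digraph G"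
  shows "wf_digraph (both_ways G)"
  using assms by (auto simp: both_ways_def wf_digraph_def)

text \<open>\<open>connected\<close> is defined through \<open>mk_symmetric\<close>, which forgets
  edge names. Since reachability depends only on the pairs of ends, it carries over to
  \<open>both_ways\<close>.\<close>

lemma arcs_ends_both_ways: "arcs_ends (both_ways G) = parcs (mk_symmetric G)"
  by (force simp: arcs_ends_def arc_to_ends_def both_ways_def parcs_mk_symmetric)

definition joins :: "('a, 'b) pre_digraph \<Rightarrow> 'b \<Rightarrow> 'a \<Rightarrow> 'a \<Rightarrow> bool" where
  "joins G e u v \<longleftrightarrow> e \<in> arcs G \<and> {tail G e, head G e} = {u, v}"

lemma joins_iff:
  "joins G e u v \<longleftrightarrow> (\<exists>fwd. (e, fwd) \<in> arcs (both_ways G) \<and>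
     tail (both_ways G) (e, fwd) = u \<and> head (both_ways G) (e, fwd) = v)"
proof
  assume "joins G e u v"
  then show "\<exists>fwd. (e, fwd) \<in> arcs (both_ways G) \<and>
     tail (both_ways G) (e, fwd) = u \<and> head (both_ways G) (e, fwd) = v"
    by (intro exI[of _ "head G e = v \<and> tail G e = u"])
      (auto simp: joins_def both_ways_def doubleton_eq_iff)
qed (auto simp: joins_def both_ways_def doubleton_eq_iff split: if_splits)

text \<open>Being a tree is expressed by connectedness and the number of edges, the form in which
  the counting argument for \<open>parent_edge\<close> uses it.\<close>

locale rooted_tree = wf_digraph T for T :: "('a, 'b) pre_digraph" +
  fixes r :: 'a
  assumes conn: "connected T"
    and fin: "finite (arcs T)"
    and card_verts: "card (verts T) = Suc (card (arcs T))"
    and root: "r \<in> verts T"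
begin

sublocale B: wf_digraph "both_ways T"
  by (rule wf_digraph_both_ways) unfold_locales

lemma verts_both_ways [simp]: "verts (both_ways T) = verts T"
  by (simp add: both_ways_def)

lemma ex_apath:
  assumes "v \<in> verts T"
  shows "\<exists>p. B.apath r p v"
proof -
  have "r \<rightarrow>\<^sup>*\<^bsub>mk_symmetric T\<^esub> v"
    using conn root assms by (auto simp: connected_def strongly_connected_def)
  then have "r \<rightarrow>\<^sup>*\<^bsub>both_ways T\<^esub> v"
    by (simp add: reachable_def arcs_ends_both_ways)
  then show ?thesis
    by (simp add: B.reachable_apath)
qed

section \<open>Distance from the root and parent edges\<close>

definition depth :: "'a \<Rightarrow> nat" where
  "depth v = (LEAST m. \<exists>p. B.awalk r p v \<and> length p = m)"

lemma depth_le: "B.awalk r p v \<Longrightarrow> depth v \<le> length p"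
  unfolding depth_def by (rule Least_le) blast

lemma ex_awalk_depth:
  assumes "v \<in> verts T"
  shows "\<exists>p. B.awalk r p v \<and> length p = depth v"
proof -
  obtain p where "B.awalk r p v"
    using ex_apath[OF assms] by (auto simp: B.apath_def)
  then show ?thesis
    unfolding depth_def using LeastI[of "\<lambda>m. \<exists>p. B.awalk r p v \<and> length p = m"] by blast
qed

text \<open>Deleting the last arc of a shortest walk from the root to \<open>v\<close> leaves a
  shorter walk to a neighbour of \<open>v\<close>.\<close>

lemma ex_parent:
  assumes "v \<in> verts T - {r}"
  shows "\<exists>e u. joins T e u v \<and> depth u < depth v"
proof -
  obtain p where p: "B.awalk r p v" "length p = depth v"
    using ex_awalk_depth assms by blast
  then have "p \<noteq> []"
    using assms by (auto simp: B.awalk_Nil_iff)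
  then obtain p' a where p': "p = p' @ [a]"
    by (metis append_butlast_last_id)
  then have "B.awalk r p' (tail (both_ways T) a)" "a \<in> arcs (both_ways T)" "head (both_ways T) a = v"
    using p(1) by (auto simp: B.awalk_simps)
  moreover from this have "depth (tail (both_ways T) a) < depth v"
    using depth_le[of p' "tail (both_ways T) a"] p(2) p' by simp
  ultimately show ?thesis
    by (metis joins_iff prod.collapse)
qed

lemma joins_cong: "joins T e u v \<Longrightarrow> joins T e u' v' \<Longrightarrow> u = u' \<and> v = v' \<or> u = v' \<and> v = u'"
  by (auto simp: joins_def doubleton_eq_iff)

text \<open>Any edge leading closer to the root may be chosen; the bijection below then makes each
  edge the parent edge of its deeper end.\<close>

definition parent_edge :: "'a \<Rightarrow> 'b" where
  "parent_edge v = (SOME e. \<exists>u. joins T e u v \<and> depth u < depth v)"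

lemma parent_edge:
  assumes "v \<in> verts T - {r}"
  shows "\<exists>u. joins T (parent_edge v) u v \<and> depth u < depth v"
  unfolding parent_edge_def using ex_parent[OF assms] by (rule someI_ex)

text \<open>
  Injective because an edge joins vertices of different depth, hence bijective because there are
  as many edges as non-root vertices.
\<close>

lemma bij_betw_parent_edge: "bij_betw parent_edge (verts T - {r}) (arcs T)"
proof -
  have inj: "inj_on parent_edge (verts T - {r})"
  proof (rule inj_onI)
    fix v w assume "v \<in> verts T - {r}" "w \<in> verts T - {r}" and "parent_edge v = parent_edge w"
    then show "v = w"
      using parent_edge[of v] parent_edge[of w] joins_cong by (metis order.asym)
  qed
  have "finite (verts T)"
    using card_verts card.infinite by fastforce
  then have "card (verts T - {r}) = card (arcs T)"
    using card_verts root by simp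
  moreover have "parent_edge ` (verts T - {r}) \<subseteq> arcs T"
    using parent_edge by (auto simp: joins_def)
  ultimately have "parent_edge ` (verts T - {r}) = arcs T"
    using inj fin by (metis card_image card_subset_eq)
  with inj show ?thesis
    by (simp add: bij_betw_def)
qed

section \<open>Paths from the root and their last edges\<close>

lemma apath_snoc:
  assumes "B.apath r (p @ [a]) v"
  shows "\<exists>u. B.apath r p u \<and> joins T (fst a) u v \<and>
    u \<in> set (B.awalk_verts r p) \<and> v \<notin> set (B.awalk_verts r p)"
proof -
  let ?u = "B.awlast r p"
  have *: "B.apath r p ?u" "B.apath ?u [a] v"
      "set (B.awalk_verts r p) \<inter> set (tl (B.awalk_verts ?u [a])) = {}"
    using assms by (simp_all add: B.apath_append_iff)
  then have "a \<in> arcs (both_ways T)" "tail (both_ways T) a = ?u" "head (both_ways T) a = v"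
    by (auto simp: B.apath_simps)
  moreover from this have "joins T (fst a) ?u v"
    unfolding joins_iff by (metis prod.collapse)
  ultimately show ?thesis
    using * by auto
qed

text \<open>A path from the root never comes closer to the root again. Otherwise its last edge would
  be the parent edge of the vertex \<open>u\<close> before \<open>v\<close>; by induction the path
  reached \<open>u\<close> through that same edge, so it visited \<open>v\<close> before.\<close>

lemma last_edge_apath:
  assumes "B.apath r (p @ [a]) v"
  shows "v \<in> verts T - {r} \<and> fst a = parent_edge v"
  using assms
proof (induction "length p" arbitrary: p a v rule: less_induct)
  case less
  obtain u where u: "B.apath r p u" "joins T (fst a) u v" "v \<notin> set (B.awalk_verts r p)"
    using apath_snoc[OF less.prems] by blast
  have "r \<in> set (B.awalk_verts r p)"
    using u(1) B.hd_in_awalk_verts(2) by blast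
  moreover have "v \<in> verts T"
    using less.prems B.awalk_last_in_verts by (auto simp: B.apath_def)
  ultimately have v: "v \<in> verts T - {r}"
    using u(3) by auto
  have "fst a \<in> arcs T"
    using u(2) by (simp add: joins_def)
  \<comment> \<open>Every edge is the parent edge of some vertex; it remains to exclude that this
    vertex is the near end \<open>u\<close> of the last edge.\<close>
  then obtain x where x: "x \<in> verts T - {r}" "fst a = parent_edge x"
    using bij_betw_parent_edge by (metis bij_betw_imp_surj_on imageE)
  then obtain w where w: "joins T (fst a) w x" "depth w < depth x"
    using parent_edge by metis
  have "x = v"
  proof (rule ccontr)
    assume "x \<noteq> v"
    then have [simp]: "x = u" "w = v"
      using joins_cong[OF u(2) w(1)] by auto
    have "p \<noteq> []"
      using u(1) x(1) by (auto simp: B.apath_simps)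
    then obtain p' b where p: "p = p' @ [b]"
      by (metis append_butlast_last_id)
    obtain t where t: "joins T (fst b) t u" "t \<in> set (B.awalk_verts r p')"
      using apath_snoc u(1) unfolding p by blast
    \<comment> \<open>By the induction hypothesis the path to \<open>u\<close> also ends with the
      parent edge of \<open>u\<close>, so the same edge would be traversed back and forth.\<close>
    have "fst b = fst a"
      using less.hyps[of p' b u] u(1) x(2) by (simp add: p)
    then have "t = v"
      using t(1) u(2) w joins_cong by fastforce
    moreover have "set (B.awalk_verts r p') \<subseteq> set (B.awalk_verts r p)"
      using u(1) unfolding p B.apath_def by (auto simp: B.awalk_verts_append)
    ultimately show False
      using t(2) u(3) by auto
  qed
  with v x(2) show ?case
    by simp
qed

text \<open>Every path from the root to \<open>v\<close> ends with the parent edge of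
  \<open>v\<close>, which gives existence; injectivity of \<open>parent_edge\<close> gives
  uniqueness. So \<open>std_head\<close> and \<open>parent_edge\<close> are mutually
  inverse.\<close>

lemma std_head_parent_edge:
  assumes "v \<in> verts T - {r}"
  shows "std_head T r (parent_edge v) = v"
  unfolding std_head_def
proof (rule the_equality)
  obtain p where p: "B.apath r p v"
    using ex_apath assms by blast
  then have "p \<noteq> []"
    using assms by (auto simp: B.apath_simps)
  then obtain p' e fwd where p': "p = p' @ [(e, fwd)]"
    by (metis append_butlast_last_id surj_pair)
  moreover have "e = parent_edge v"
    using last_edge_apath p unfolding p' by fastforce
  ultimately show "\<exists>p fwd. B.apath r (p @ [(parent_edge v, fwd)]) v"
    using p by blast
next
  fix w assume "\<exists>p fwd. B.apath r (p @ [(parent_edge v, fwd)]) w"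
  then have "w \<in> verts T - {r}" "parent_edge w = parent_edge v"
    using last_edge_apath by fastforce+
  then show "w = v"
    using assms bij_betw_imp_inj_on[OF bij_betw_parent_edge] by (simp add: inj_on_def)
qed

lemma parent_edge_std_head:
  assumes "e \<in> arcs T"
  shows "std_head T r e \<in> verts T - {r}" "parent_edge (std_head T r e) = e"
proof -
  obtain v where "v \<in> verts T - {r}" "e = parent_edge v"
    using assms bij_betw_imp_surj_on[OF bij_betw_parent_edge] by blast
  then show "std_head T r e \<in> verts T - {r}" "parent_edge (std_head T r e) = e"
    by (simp_all add: std_head_parent_edge)
qed

lemma bij_betw_std_head: "bij_betw (std_head T r) (arcs T) (verts T - {r})"
proof (rule bij_betw_byWitness[where f' = parent_edge])
  show "parent_edge ` (verts T - {r}) \<subseteq> arcs T"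
    using bij_betw_imp_surj_on[OF bij_betw_parent_edge] by simp
qed (use parent_edge_std_head std_head_parent_edge in auto)

lemma joins_std_head:
  assumes "e \<in> arcs T"
  shows "\<exists>u. joins T e u (std_head T r e) \<and> depth u < depth (std_head T r e)"
  using parent_edge[of "std_head T r e"] parent_edge_std_head[OF assms] by simp

end

lemma n_tree_rooted_tree:
  assumes "n_tree n T" "r \<in> {1..n}"
  shows "rooted_tree T r"
  using assms
  by (auto simp: n_tree_def rooted_tree_def rooted_tree_axioms_def)

lemma head_perm_permutes:
  assumes "n_tree n T" "r \<in> {1..n}"
  shows "head_perm n T r permutes {1..n}"
proof -
  interpret rooted_tree T r
    using assms by (rule n_tree_rooted_tree)
  have T: "verts T = {1..n}" "arcs T = {1..<n}"
    using assms by (auto simp: n_tree_def)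
  have "bij_betw (\<lambda>m. m - 1) {2..n} {1..<n}"
    by (rule bij_betw_byWitness[where f' = Suc]) auto
  from bij_betw_trans[OF this] have "bij_betw (\<lambda>m. std_head T r (m - 1)) {2..n} ({1..n} - {r})"
    using bij_betw_std_head by (simp add: T o_def)
  then have "bij_betw (head_perm n T r) {2..n} ({1..n} - {r})"
    by (rule bij_betw_cong[THEN iffD1, rotated]) (auto simp: head_perm_def)
  moreover have "bij_betw (head_perm n T r) {1} {r}"
    by (simp add: head_perm_def)
  ultimately have "bij_betw (head_perm n T r) ({1} \<union> {2..n}) ({r} \<union> ({1..n} - {r}))"
    by (intro bij_betw_combine) auto
  moreover have "{1} \<union> {2..n} = {1..n}" "{r} \<union> ({1..n} - {r}) = {1..n}"
    using assms(2) by auto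
  ultimately have "bij_betw (head_perm n T r) {1..n} {1..n}"
    by simp
  then show ?thesis
    by (rule bij_imp_permutes) (use assms(2) in \<open>auto simp: head_perm_def\<close>)
qed

subsection \<open>The incidence matrix\<close>

text \<open>Row \<open>i > 0\<close> belongs to the edge named \<open>i\<close>, column
  \<open>v\<close> to the vertex \<open>Suc v\<close>. Row 0 stands for an imaginary edge entering
  the root, just as \<open>head_perm\<close> puts the root before the heads.\<close>

definition incidence_mat :: "nat \<Rightarrow> (nat, nat) pre_digraph \<Rightarrow> nat \<Rightarrow> 'a::comm_ring_1 mat" where
  "incidence_mat n T r = mat n n (\<lambda>(i, v). if i = 0 then of_bool (Suc v = r)
     else of_bool (Suc v = head T i) - of_bool (Suc v = tail T i))"

lemma incidence_mat_carrier [simp]: "incidence_mat n T r \<in> carrier_mat n n"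
  by (simp add: incidence_mat_def)

lemma prod_signs:
  assumes "finite A" "B \<subseteq> A"
  shows "(\<Prod>j\<in>A. if j \<in> B then - 1 else 1) = ((-1) ^ card B :: 'a::comm_ring_1)"
  using assms by (simp add: prod.If_cases Int_absorb1)

text \<open>
  In a nonzero term of the Leibniz expansion, every row that differs from \<open>head_perm\<close> picks the
  parent instead of the standard head and so decreases the sum of the depths, which is the same
  for all permutations.
\<close>

lemma det_incidence_mat:
  assumes T: "n_tree n T" and r: "r \<in> {1..n}"
  shows "det (incidence_mat n T r :: 'a::comm_ring_1 mat) = of_int (rooted_tree_sign n T r)"
proof -
  interpret rooted_tree T r
    using assms by (rule n_tree_rooted_tree)
  have arcs: "arcs T = {1..<n}"
    using T by (auto simp: n_tree_def)
  let ?A = "incidence_mat n T r :: 'a mat"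
  let ?h = "std_head T r"
  have joins: "\<exists>u. joins T i u (?h i) \<and> depth u < depth (?h i)" if "i \<in> {1..<n}" for i
    using joins_std_head that by (simp add: arcs)
  \<comment> \<open>Conjugating \<open>head_perm\<close> with the shift from vertices to matrix
    indices preserves its sign.\<close>
  define q where "q = map_permutation {1..n} (\<lambda>m. m - 1) (head_perm n T r)"
  have bij: "bij_betw (\<lambda>m. m - 1) {1..n} {0..<n}"
    by (rule bij_betw_byWitness[where f' = Suc]) auto
  note perm = head_perm_permutes[OF T r]
  have q: "q permutes {0..<n}"
    unfolding q_def using bij perm by (rule map_permutation_permutes)
  have sign_q: "sign q = sign (head_perm n T r)"
    unfolding q_def using bij perm by (intro sign_map_permutation) (auto simp: bij_betw_def)
  have Suc_q: "Suc (q i) = head_perm n T r (Suc i)" if "i < n" for i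
  proof -
    have "q (Suc i - 1) = head_perm n T r (Suc i) - 1"
      unfolding q_def using bij that by (intro map_permutation_apply) (auto simp: bij_betw_def)
    moreover have "head_perm n T r (Suc i) \<in> {1..n}"
      using that by (subst permutes_in_image[OF perm]) simp
    ultimately show ?thesis
      by simp
  qed
  have q0: "Suc (q 0) = r"
    using Suc_q[of 0] r by (simp add: head_perm_def)
  have q1: "Suc (q i) = ?h i" if "i \<in> {1..<n}" for i
    using Suc_q[of i] that by (simp add: head_perm_def)
  let ?t = "\<lambda>p. signof p * (\<Prod>i = 0..<n. ?A $$ (i, p i)) :: 'a"
  have zero: "?t p = 0" if p: "p permutes {0..<n}" and "p \<noteq> q" for p
  proof (rule ccontr)
    assume "?t p \<noteq> 0"
    then have nz: "?A $$ (i, p i) \<noteq> 0" if "i < n" for i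
      using that by (metis atLeast0LessThan finite_lessThan lessThan_iff mult_zero_right prod_zero)
    have pn: "p i < n" if "i < n" for i
      using permutes_in_image[OF p, of i] that by simp
    have row: "p i = q i \<or> depth (Suc (p i)) < depth (Suc (q i))" if i: "i < n" for i
    proof (cases "i = 0")
      case True
      then have "Suc (p i) = r"
        using nz[OF i] pn[OF i] i by (simp add: incidence_mat_def split: if_splits)
      then show ?thesis
        using q0 True by auto
    next
      case False
      then have "i \<in> {1..<n}"
        using i by simp
      then obtain u where u: "joins T i u (?h i)" "depth u < depth (?h i)"
        using joins by blast
      have "Suc (p i) \<in> {tail T i, head T i}"
        using nz[OF i] pn[OF i] i False by (auto simp: incidence_mat_def)
      then have "Suc (p i) = u \<or> Suc (p i) = ?h i"
        using u(1) by (auto simp: joins_def)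
      then show ?thesis
        using u(2) q1[OF \<open>i \<in> {1..<n}\<close>] by auto
    qed
    have "\<exists>i. p i \<noteq> q i"
      using \<open>p \<noteq> q\<close> by (auto simp: fun_eq_iff)
    then obtain j where "p j \<noteq> q j"
      by blast
    moreover from this have "j < n"
      using permutes_not_in[OF p, of j] permutes_not_in[OF q, of j] by fastforce
    ultimately have "(\<Sum>i = 0..<n. depth (Suc (p i))) < (\<Sum>i = 0..<n. depth (Suc (q i)))"
      using row[of j] row
      by (intro sum_strict_mono_ex1) (force intro: less_imp_le bexI[of _ j])+
    moreover have "(\<Sum>i = 0..<n. depth (Suc (f i))) = (\<Sum>i = 0..<n. depth (Suc i))"
      if "f permutes {0..<n}" for f
      using sum.permute[OF that, of "\<lambda>i. depth (Suc i)"] by (simp add: o_def)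
    ultimately show False
      using p q by simp
  qed
  have "det ?A = (\<Sum>p | p permutes {0..<n}. ?t p)"
    by (rule det_def') simp
  also have "\<dots> = (\<Sum>p\<in>{q}. ?t p)"
    using q zero by (intro sum.mono_neutral_right) (auto simp: finite_permutations)
  also have "\<dots> = ?t q"
    by simp
  also have "(\<Prod>i = 0..<n. ?A $$ (i, q i)) = ?A $$ (0, q 0) * (\<Prod>i = 1..<n. ?A $$ (i, q i))"
    using r by (simp add: prod.atLeast_Suc_lessThan)
  also have "?A $$ (0, q 0) = 1"
    using q0 r permutes_in_image[OF q, of 0] by (simp add: incidence_mat_def)
  also have "(\<Prod>i = 1..<n. ?A $$ (i, q i)) =
      (\<Prod>i = 1..<n. if i \<in> reversed_edges T r then -1 else 1)"
  proof (intro prod.cong refl)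
    fix i assume i: "i \<in> {1..<n}"
    then obtain u where u: "joins T i u (?h i)" "depth u < depth (?h i)"
      using joins by blast
    \<comment> \<open>The ends of the edge differ, so the two indicators in the entry cannot
      cancel.\<close>
    then have "u \<noteq> ?h i"
      by auto
    then show "?A $$ (i, q i) = (if i \<in> reversed_edges T r then -1 else 1)"
      using i u(1) q1[OF i] permutes_in_image[OF q, of i]
      by (auto simp: incidence_mat_def reversed_edges_def joins_def doubleton_eq_iff)
  qed
  also have "\<dots> = (-1) ^ card (reversed_edges T r)"
    by (rule prod_signs) (auto simp: reversed_edges_def arcs)
  finally show ?thesis
    by (simp add: rooted_tree_sign_def sign_q mult.commute)
qed

text \<open>This is what remains of the product of incidence and binomial matrix after row 0 and
  column 0 are deleted, hence the lower index \<open>Suc j\<close>.\<close>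

definition edge_difference_mat ::
    "nat \<Rightarrow> (nat, nat) pre_digraph \<Rightarrow> (nat \<Rightarrow> 'a::field_char_0) \<Rightarrow> 'a mat" where
  "edge_difference_mat m T x = mat m m (\<lambda>(i, j).
     (x (head T (Suc i)) gchoose Suc j) - (x (tail T (Suc i)) gchoose Suc j))"

lemma n_tree_arcD:
  assumes "n_tree n T" "e \<in> arcs T"
  shows "tail T e \<in> {1..n}" "head T e \<in> {1..n}"
  using assms by (auto simp: n_tree_def wf_digraph_def)

text \<open>An edge row of the product is the difference of the binomial rows of its head and tail,
  and the root row is that of the root. Since \<open>x gchoose 0 = 1\<close>, column 0 is the unit
  vector with its 1 in the root row; the determinant is expanded along it.\<close>

lemma det_incidence_mult_binomial:
  fixes x :: "nat \<Rightarrow> 'a::field_char_0"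
  assumes T: "n_tree (Suc m) T" and r: "r \<in> {1..Suc m}"
  shows "det (incidence_mat (Suc m) T r * binomial_mat (Suc m) x) = det (edge_difference_mat m T x)"
proof -
  let ?A = "incidence_mat (Suc m) T r :: 'a mat"
  let ?P = "?A * binomial_mat (Suc m) x"
  have pick: "(\<Sum>v<Suc m. of_bool (Suc v = w) * f (Suc v)) = f w"
    if "w \<in> {1..Suc m}" for w and f :: "nat \<Rightarrow> 'a"
  proof -
    have "(\<Sum>v<Suc m. of_bool (Suc v = w) * f (Suc v)) =
        (\<Sum>v\<in>{w - 1}. of_bool (Suc v = w) * f (Suc v))"
      using that by (intro sum.mono_neutral_right) auto
    then show ?thesis
      using that by simp
  qed
  have entry: "?P $$ (i, j) = (\<Sum>v<Suc m. ?A $$ (i, v) * (x (Suc v) gchoose j))"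
    if "i < Suc m" "j < Suc m" for i j
    using that unfolding incidence_mat_def binomial_mat_def
    by (simp add: scalar_prod_def lessThan_atLeast0 del: sum.atLeast0_lessThan_Suc sum.op_ivl_Suc)
  have first: "?P $$ (0, 0) = 1"
    using pick[OF r, of "\<lambda>_. 1"] by (subst entry) (simp_all add: incidence_mat_def del: sum.lessThan_Suc)
  have row: "?P $$ (Suc i, j) = (x (head T (Suc i)) gchoose j) - (x (tail T (Suc i)) gchoose j)"
    if "i < m" "j < Suc m" for i j
  proof -
    have "Suc i \<in> arcs T"
      using T that(1) by (simp add: n_tree_def)
    note ends = n_tree_arcD[OF T this]
    have "?P $$ (Suc i, j) = (\<Sum>v<Suc m. (of_bool (Suc v = head T (Suc i)) * (x (Suc v) gchoose j)
        - of_bool (Suc v = tail T (Suc i)) * (x (Suc v) gchoose j)))"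
      using that by (subst entry) (auto simp: incidence_mat_def algebra_simps intro!: sum.cong)
    then show ?thesis
      using pick[OF ends(1), of "\<lambda>w. x w gchoose j"] pick[OF ends(2), of "\<lambda>w. x w gchoose j"]
      by (simp only: sum_subtractf)
  qed
  have "det ?P = ?P $$ (0, 0) * det (mat m m (\<lambda>(i, j). ?P $$ (Suc i, Suc j)))"
    by (rule det_first_column) (auto simp: row intro!: mult_carrier_mat[of _ _ "Suc m"])
  also have "mat m m (\<lambda>(i, j). ?P $$ (Suc i, Suc j)) = edge_difference_mat m T x"
    unfolding edge_difference_mat_def by (intro eq_matI) (auto simp: row)
  finally show ?thesis
    by (simp add: first)
qed

lemma rooted_tree_sign_square: "rooted_tree_sign n T r * rooted_tree_sign n T r = 1"
  by (simp add: rooted_tree_sign_def sign_def)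

lemma tree_sign_square: "tree_sign n T * tree_sign n T = 1"
  by (simp add: tree_sign_def rooted_tree_sign_square)

lemma tree_sign_mult_det_binomial:
  fixes x :: "nat \<Rightarrow> 'a::field_char_0"
  assumes T: "n_tree (Suc m) T"
  shows "of_int (tree_sign (Suc m) T) * det (edge_difference_mat m T x) =
    det (binomial_mat (Suc m) x)"
proof -
  \<comment> \<open>The root has to be the one chosen in \<open>tree_sign\<close>;
    \<open>det_incidence_mat\<close> holds for every root.\<close>
  define r where "r = (SOME r. r \<in> {1..Suc m})"
  have r: "r \<in> {1..Suc m}"
    unfolding r_def by (rule someI[of _ 1]) simp
  have "det (edge_difference_mat m T x) =
      det (incidence_mat (Suc m) T r) * det (binomial_mat (Suc m) x)"
    unfolding det_incidence_mult_binomial[OF T r, symmetric]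
    by (rule det_mult[of _ "Suc m"]) simp_all
  also have "det (incidence_mat (Suc m) T r :: 'a mat) = of_int (tree_sign (Suc m) T)"
    unfolding tree_sign_def r_def[symmetric] by (rule det_incidence_mat[OF T r])
  finally have "of_int (tree_sign (Suc m) T) * det (edge_difference_mat m T x) =
      of_int (tree_sign (Suc m) T * tree_sign (Suc m) T) * det (binomial_mat (Suc m) x)"
    by (simp add: mult.assoc)
  then show ?thesis
    by (simp add: tree_sign_square)
qed

subsection \<open>Summation over admissible vectors\<close>

text \<open>The values of \<open>l j\<close> allowed by the edge \<open>j\<close>, already shifted
  by \<open>j\<close>. If both ends have equal value, the second branch is empty.\<close>

definition edge_interval :: "(nat, nat) pre_digraph \<Rightarrow> (nat \<Rightarrow> int) \<Rightarrow> nat \<Rightarrow> int set" where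
  "edge_interval T k j =
     (let a = k (tail T j) + int (tail T j) - int j; b = k (head T j) + int (head T j) - int j
      in if a < b then {a..<b} else {b..<a})"

lemma finite_edge_interval [simp]: "finite (edge_interval T k j)"
  by (simp add: edge_interval_def Let_def)

lemma admissible_iff: "admissible T k l \<longleftrightarrow> (\<forall>j\<in>arcs T. l j \<in> edge_interval T k j)"
  by (auto simp: admissible_def edge_interval_def Let_def)

lemma admissible_cong:
  assumes "n_tree n T" "\<And>i. i \<in> {1..n} \<Longrightarrow> k i = k' i" "\<And>i. i \<in> {1..<n} \<Longrightarrow> l i = l' i"
  shows "admissible T k l \<longleftrightarrow> admissible T k' l'"
  unfolding admissible_def Let_def
  using n_tree_arcD[OF assms(1)] assms
  by (intro ball_cong) (auto simp: n_tree_def)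

lemma inversions_cong:
  assumes "n_tree n T" "\<And>i. i \<in> {1..n} \<Longrightarrow> k i = k' i"
  shows "inversions T k = inversions T k'"
  unfolding inversions_def using n_tree_arcD[OF assms(1)] assms(2)
  by (intro Collect_cong) auto

lemma sum_int_telescope:
  fixes F :: "int \<Rightarrow> 'a::ab_group_add"
  assumes "a \<le> b"
  shows "(\<Sum>y\<in>{a..<b}. F (y + 1) - F y) = F b - F a"
  using assms
proof (induction b rule: int_ge_induct)
  case (step b)
  then have "{a..<b + 1} = insert b {a..<b}"
    by auto
  then show ?case
    using step by simp
qed simp

text \<open>By Pascal's rule \<open>gchoose p\<close> is the forward difference of
  \<open>gchoose Suc p\<close>, so the sum telescopes. At an inversion the limits are exchanged and
  the sign restores the order head minus tail; for equal ends both sides are 0.\<close>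

lemma sum_edge_interval:
  assumes "j \<in> arcs T"
  shows "(if j \<in> inversions T k then - 1 else 1) *
      (\<Sum>y\<in>edge_interval T k j. of_int (y + int j) gchoose p) =
    (of_int (k (head T j) + int (head T j)) gchoose Suc p) -
    (of_int (k (tail T j) + int (tail T j)) gchoose Suc p :: 'a::field_char_0)"
proof -
  let ?F = "\<lambda>y. of_int (y + int j) gchoose Suc p :: 'a"
  have "?F (y + 1) - ?F y = of_int (y + int j) gchoose p" for y
    using gbinomial_Suc_Suc[of "of_int (y + int j) :: 'a" p] by (simp add: algebra_simps)
  then have "(\<Sum>y\<in>{a..<b}. of_int (y + int j) gchoose p) = ?F b - ?F a" if "a \<le> b" for a b
    using sum_int_telescope[OF that, of ?F] by simp
  then show ?thesis
    using assms by (auto simp: edge_interval_def Let_def inversions_def)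
qed

text \<open>Row \<open>i\<close> of the binomial matrix depends on \<open>l (Suc i)\<close> alone.
  In each Leibniz term the sum over all \<open>l\<close> therefore becomes a product of sums, one
  for each edge.\<close>

lemma sum_admissible_det_binomial:
  assumes T: "n_tree (Suc m) T"
  shows "(-1) ^ card (inversions T k) *
      (\<Sum>l\<in>Pi\<^sub>E {1..<Suc m} (edge_interval T k). det (binomial_mat m (\<lambda>i. of_int (l i + int i)))) =
    (det (edge_difference_mat m T (\<lambda>i. of_int (k i + int i))) :: 'a::field_char_0)"
proof -
  have arcs: "arcs T = {1..<Suc m}"
    using T by (simp add: n_tree_def)
  let ?s = "\<lambda>j. if j \<in> inversions T k then - 1 else 1 :: 'a"
  let ?I = "Pi\<^sub>E {1..<Suc m} (edge_interval T k)"
  let ?P = "{p. p permutes {0..<m}}"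
  let ?x = "\<lambda>i. of_int (k i + int i) :: 'a"
  \<comment> \<open>Each edge receives its own sign, to be absorbed by the sum over its
    interval.\<close>
  have sign: "(-1) ^ card (inversions T k) = (\<Prod>j\<in>{1..<Suc m}. ?s j)"
    by (rule prod_signs[symmetric]) (auto simp: inversions_def arcs)
  have "(\<Sum>l\<in>?I. det (binomial_mat m (\<lambda>i. of_int (l i + int i)))) =
      (\<Sum>l\<in>?I. \<Sum>p\<in>?P. signof p * (\<Prod>i = 0..<m. of_int (l (Suc i) + int (Suc i)) gchoose p i :: 'a))"
  proof (intro sum.cong refl)
    fix l :: "nat \<Rightarrow> int"
    have "det (binomial_mat m (\<lambda>i. of_int (l i + int i) :: 'a)) = (\<Sum>p\<in>?P. signof p *
        (\<Prod>i = 0..<m. binomial_mat m (\<lambda>i. of_int (l i + int i)) $$ (i, p i)))"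
      by (rule det_def') simp
    also have "\<dots> = (\<Sum>p\<in>?P. signof p * (\<Prod>i = 0..<m. of_int (l (Suc i) + int (Suc i)) gchoose p i))"
    proof (intro sum.cong refl arg_cong2[where f = "(*)"] prod.cong)
      fix p i assume "p \<in> ?P" "i \<in> {0..<m}"
      then show "binomial_mat m (\<lambda>i. of_int (l i + int i)) $$ (i, p i) =
          (of_int (l (Suc i) + int (Suc i)) gchoose p i :: 'a)"
        using permutes_in_image[of p "{0..<m}" i] by (simp add: binomial_mat_def)
    qed
    finally show "det (binomial_mat m (\<lambda>i. of_int (l i + int i) :: 'a)) =
      (\<Sum>p\<in>?P. signof p * (\<Prod>i = 0..<m. of_int (l (Suc i) + int (Suc i)) gchoose p i))" .
  qed
  also have "\<dots> = (\<Sum>p\<in>?P. signof p *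
      (\<Sum>l\<in>?I. \<Prod>i = 0..<m. of_int (l (Suc i) + int (Suc i)) gchoose p i))"
    by (subst sum.swap) (simp add: sum_distrib_left)
  \<comment> \<open>Expanding the product of sums picks one value from every interval, that is, a
    vector \<open>l\<close>. Edges are numbered from 1 and rows from 0, hence
    \<open>p (j - 1)\<close>.\<close>
  also have "\<dots> = (\<Sum>p\<in>?P. signof p *
      (\<Prod>j\<in>{1..<Suc m}. \<Sum>y\<in>edge_interval T k j. of_int (y + int j) gchoose p (j - 1)))"
  proof (intro sum.cong refl arg_cong2[where f = "(*)"])
    fix p :: "nat \<Rightarrow> nat"
    have "(\<Sum>l\<in>?I. \<Prod>i = 0..<m. of_int (l (Suc i) + int (Suc i)) gchoose p i :: 'a) =
        (\<Sum>l\<in>?I. \<Prod>j\<in>{1..<Suc m}. of_int (l j + int j) gchoose p (j - 1))"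
      unfolding One_nat_def prod.shift_bounds_Suc_ivl by simp
    then show "(\<Sum>l\<in>?I. \<Prod>i = 0..<m. of_int (l (Suc i) + int (Suc i)) gchoose p i :: 'a) =
        (\<Prod>j\<in>{1..<Suc m}. \<Sum>y\<in>edge_interval T k j. of_int (y + int j) gchoose p (j - 1))"
      by (subst prod_sum_PiE) auto
  qed
  finally have "(\<Sum>l\<in>?I. det (binomial_mat m (\<lambda>i. of_int (l i + int i)))) =
      (\<Sum>p\<in>?P. signof p *
        (\<Prod>j\<in>{1..<Suc m}. \<Sum>y\<in>edge_interval T k j. of_int (y + int j) gchoose p (j - 1) :: 'a))" .
  then have "(-1) ^ card (inversions T k) *
      (\<Sum>l\<in>?I. det (binomial_mat m (\<lambda>i. of_int (l i + int i)))) =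
      (\<Sum>p\<in>?P. signof p * (\<Prod>j\<in>{1..<Suc m}.
        ?s j * (\<Sum>y\<in>edge_interval T k j. of_int (y + int j) gchoose p (j - 1))))"
    by (simp only: sign, subst sum_distrib_left) (simp only: prod.distrib mult.left_commute)
  also have "\<dots> = (\<Sum>p\<in>?P. signof p * (\<Prod>j\<in>{1..<Suc m}.
        (?x (head T j) gchoose Suc (p (j - 1))) - (?x (tail T j) gchoose Suc (p (j - 1)))))"
    by (intro sum.cong refl arg_cong2[where f = "(*)"] prod.cong sum_edge_interval) (simp add: arcs)
  also have "\<dots> = (\<Sum>p\<in>?P. signof p * (\<Prod>i = 0..<m. edge_difference_mat m T ?x $$ (i, p i)))"
  proof (intro sum.cong refl arg_cong2[where f = "(*)"])
    fix p assume p: "p \<in> ?P"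
    show "(\<Prod>j\<in>{1..<Suc m}.
        (?x (head T j) gchoose Suc (p (j - 1))) - (?x (tail T j) gchoose Suc (p (j - 1)))) =
        (\<Prod>i = 0..<m. edge_difference_mat m T ?x $$ (i, p i))"
      unfolding One_nat_def prod.shift_bounds_Suc_ivl
    proof (intro prod.cong refl)
      fix i assume "i \<in> {0..<m}"
      then show "(?x (head T (Suc i)) gchoose Suc (p (Suc i - Suc 0))) -
          (?x (tail T (Suc i)) gchoose Suc (p (Suc i - Suc 0))) =
          edge_difference_mat m T ?x $$ (i, p i)"
        using p permutes_in_image[of p "{0..<m}" i] by (simp add: edge_difference_mat_def)
    qed
  qed
  also have "\<dots> = det (edge_difference_mat m T ?x)"
    by (rule det_def'[symmetric]) (simp add: edge_difference_mat_def)
  finally show ?thesis .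
qed

subsection \<open>Peeling off the last tree\<close>

lemma tree_sequence_Suc:
  "tree_sequence (Suc m) T \<longleftrightarrow> tree_sequence m T \<and> n_tree (Suc m) (T (Suc m))"
  by (auto simp: tree_sequence_def atLeastAtMostSuc_conv)

text \<open>The top vector is forced by \<open>k\<close>; forgetting it leaves a sequence of order
  \<open>m\<close> whose own top vector \<open>L m\<close> ranges over the admissible ones.
  \<open>restrict\<close> and \<open>undefined\<close> keep all functions extensional, and
  \<open>m \<ge> 1\<close> ensures that level \<open>m\<close> exists.\<close>

lemma GT_tree_sequences_bij_betw:
  assumes m: "m \<ge> 1" and T: "n_tree (Suc m) (T (Suc m))"
  shows "bij_betw (\<lambda>(l, L). L(Suc m := restrict k {1..Suc m}))
    (SIGMA l:Pi\<^sub>E {1..<Suc m} (edge_interval (T (Suc m)) k). GT_tree_sequences m T l)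
    (GT_tree_sequences (Suc m) T k)"
proof (rule bij_betw_byWitness[where f' = "\<lambda>L. (L m, L(Suc m := undefined))"])
  let ?k = "restrict k {1..Suc m}"
  let ?S = "SIGMA l:Pi\<^sub>E {1..<Suc m} (edge_interval (T (Suc m)) k). GT_tree_sequences m T l"
  have arcs: "arcs (T (Suc m)) = {1..<Suc m}"
    using T by (simp add: n_tree_def)
  have ivl: "{1..Suc m} = insert (Suc m) {1..m}" "{2..Suc m} = insert (Suc m) {2..m}"
    using m by auto
  have adm: "admissible (T (Suc m)) k' l \<longleftrightarrow> admissible (T (Suc m)) k l"
    if "\<And>j. j \<in> {1..Suc m} \<Longrightarrow> k' j = k j" for k' l
    using admissible_cong[OF T, of k' k l l] that by blast
  show "\<forall>a\<in>?S. (\<lambda>L. (L m, L(Suc m := undefined))) ((\<lambda>(l, L). L(Suc m := ?k)) a) = a"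
  proof
    fix a assume "a \<in> ?S"
    then obtain l L where a: "a = (l, L)"
      and l: "l \<in> Pi\<^sub>E {1..<Suc m} (edge_interval (T (Suc m)) k)"
      and L: "L \<in> GT_tree_sequences m T l"
      by blast
    have "L m \<in> {1..m} \<rightarrow>\<^sub>E UNIV" "\<forall>j\<in>{1..m}. L m j = l j"
      using L m by (auto simp: GT_tree_sequences_def PiE_iff)
    moreover have "l \<in> {1..m} \<rightarrow>\<^sub>E UNIV"
      using l by (auto simp: PiE_iff atLeastLessThanSuc_atLeastAtMost)
    ultimately have "L m = l"
      by (intro extensionalityI[of _ "{1..m}"]) (auto simp: PiE_iff)
    \<comment> \<open>An extensional \<open>L\<close> on levels \<open>1..m\<close> is
      \<open>undefined\<close> at level \<open>Suc m\<close>, so clearing the added level restores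
      it exactly.\<close>
    moreover have "L (Suc m) = undefined"
      using L by (auto simp: GT_tree_sequences_def PiE_iff extensional_def)
    ultimately show "(\<lambda>L. (L m, L(Suc m := undefined))) ((\<lambda>(l, L). L(Suc m := ?k)) a) = a"
      by (auto simp: a fun_upd_idem)
  qed
  show "\<forall>L\<in>GT_tree_sequences (Suc m) T k.
      (\<lambda>(l, L). L(Suc m := ?k)) (L m, L(Suc m := undefined)) = L"
  proof
    fix L assume "L \<in> GT_tree_sequences (Suc m) T k"
    then have "L (Suc m) \<in> {1..Suc m} \<rightarrow>\<^sub>E UNIV" "\<forall>j\<in>{1..Suc m}. L (Suc m) j = k j"
      by (auto simp: GT_tree_sequences_def)
    then have "L (Suc m) = ?k"
      by (intro PiE_ext[where k = "{1..Suc m}"]) auto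
    then show "(\<lambda>(l, L). L(Suc m := ?k)) (L m, L(Suc m := undefined)) = L"
      by (simp add: fun_upd_idem)
  qed
  show "(\<lambda>(l, L). L(Suc m := ?k)) ` ?S \<subseteq> GT_tree_sequences (Suc m) T k"
  proof clarify
    fix l L assume l: "l \<in> Pi\<^sub>E {1..<Suc m} (edge_interval (T (Suc m)) k)"
      and L: "L \<in> GT_tree_sequences m T l"
    have "admissible (T (Suc m)) k l"
      using l by (auto simp: admissible_iff arcs)
    moreover have "L m j = l j" if "j \<in> {1..<Suc m}" for j
      using L that by (auto simp: GT_tree_sequences_def)
    ultimately have "admissible (T (Suc m)) ?k (L m)"
      using admissible_cong[OF T, of ?k k "L m" l] by auto
    moreover have "L(Suc m := ?k) \<in> (\<Pi>\<^sub>E i\<in>{1..Suc m}. {1..i} \<rightarrow>\<^sub>E UNIV)"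
      using L unfolding GT_tree_sequences_def ivl(1) by (intro PiE_fun_upd) auto
    ultimately show "L(Suc m := ?k) \<in> GT_tree_sequences (Suc m) T k"
      using L unfolding GT_tree_sequences_def ivl(2) by auto
  qed
  show "(\<lambda>L. (L m, L(Suc m := undefined))) ` GT_tree_sequences (Suc m) T k \<subseteq> ?S"
  proof clarify
    fix L assume L: "L \<in> GT_tree_sequences (Suc m) T k"
    have "admissible (T (Suc m)) (L (Suc m)) (L m)"
      using L m unfolding GT_tree_sequences_def ivl(2) by auto
    moreover have "L (Suc m) j = k j" if "j \<in> {1..Suc m}" for j
      using L that by (auto simp: GT_tree_sequences_def)
    ultimately have "admissible (T (Suc m)) k (L m)"
      using adm by blast
    moreover have "L m \<in> {1..m} \<rightarrow>\<^sub>E UNIV"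
      using L m by (auto simp: GT_tree_sequences_def)
    ultimately have "L m \<in> Pi\<^sub>E {1..<Suc m} (edge_interval (T (Suc m)) k)"
      by (auto simp: PiE_iff admissible_iff arcs atLeastLessThanSuc_atLeastAtMost)
    moreover have "L(Suc m := undefined) \<in> (\<Pi>\<^sub>E i\<in>{1..m}. {1..i} \<rightarrow>\<^sub>E UNIV)"
      using L unfolding GT_tree_sequences_def ivl(1) by (intro fun_upd_in_PiE) auto
    then have "L(Suc m := undefined) \<in> GT_tree_sequences m T (L m)"
      using L unfolding GT_tree_sequences_def ivl(2) by auto
    ultimately show "L m \<in> Pi\<^sub>E {1..<Suc m} (edge_interval (T (Suc m)) k) \<and>
        L(Suc m := undefined) \<in> GT_tree_sequences m T (L m)"
      by blast
  qed
qed

section \<open>Inversions and signs across the levels\<close>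

lemma finite_inversions: "n_tree n T \<Longrightarrow> finite (inversions T k)"
  by (simp add: n_tree_def inversions_def)

lemma card_GT_inversions:
  assumes "tree_sequence n T"
  shows "card (GT_inversions n T L) = (\<Sum>i\<in>{2..n}. card (inversions (T i) (L i)))"
proof -
  have "finite (inversions (T i) (L i))" if "i \<in> {2..n}" for i
    using assms that by (intro finite_inversions[of i]) (auto simp: tree_sequence_def)
  then show ?thesis
    by (simp add: GT_inversions_def)
qed

text \<open>The new level contributes its own inversions and tree sign. The vector \<open>k'\<close>
  leaves room for the restriction of \<open>k\<close> that the bijection inserts.\<close>

lemma GT_sign_Suc:
  assumes m: "m \<ge> 1" and T: "tree_sequence (Suc m) T"
    and k': "\<And>j. j \<in> {1..Suc m} \<Longrightarrow> k' j = k j"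
  shows "GT_sign (Suc m) T (L(Suc m := k')) =
    tree_sign (Suc m) (T (Suc m)) * (-1) ^ card (inversions (T (Suc m)) k) * GT_sign m T L"
proof -
  have T': "tree_sequence m T" "n_tree (Suc m) (T (Suc m))"
    using T by (simp_all add: tree_sequence_Suc)
  have "{2..Suc m} = insert (Suc m) {2..m}"
    using m by auto
  then have "card (GT_inversions (Suc m) T (L(Suc m := k'))) =
      card (inversions (T (Suc m)) k) + card (GT_inversions m T L)"
    using inversions_cong[OF T'(2), of k' k] k'
    by (auto simp: card_GT_inversions T T' intro!: sum.cong)
  then show ?thesis
    by (simp add: GT_sign_def tree_sequence_sign_def power_add algebra_simps)
qed

lemma GT_tree_sequences_1: "GT_tree_sequences 1 T k = {\<lambda>i\<in>{1}. restrict k {1}}"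
  unfolding GT_tree_sequences_def
proof (intro equalityI subsetI; clarsimp)
  fix L assume L: "L \<in> (\<Pi>\<^sub>E i\<in>{Suc 0}. {Suc 0..i} \<rightarrow>\<^sub>E UNIV)" "L (Suc 0) (Suc 0) = k (Suc 0)"
  then have "L (Suc 0) = restrict k {Suc 0}"
    by (intro PiE_ext[where k = "{Suc 0}"]) (auto simp: PiE_iff)
  then show "L = (\<lambda>i\<in>{Suc 0}. restrict k {Suc 0})"
    using L(1) by (intro PiE_ext[where k = "{Suc 0}"]) (auto simp: PiE_iff)
qed

lemma tree_sign_1:
  assumes "n_tree 1 T"
  shows "tree_sign 1 T = 1"
proof -
  have "reversed_edges T 1 = {}"
    using assms by (auto simp: reversed_edges_def n_tree_def)
  moreover have "head_perm 1 T 1 = id"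
    by (auto simp: head_perm_def fun_eq_iff)
  moreover have "(SOME r. r \<in> {1..1::nat}) = 1"
    by (rule some_equality) auto
  ultimately show ?thesis
    by (simp add: tree_sign_def rooted_tree_sign_def)
qed

text \<open>Finiteness is part of the induction because the sum is regrouped by the vector at level
  \<open>m\<close>; \<open>k\<close> must vary because this vector takes its place in the induction
  hypothesis.\<close>

lemma signed_GT_enumeration_eq_det:
  assumes "n \<ge> 1" "tree_sequence n T"
  shows "finite (GT_tree_sequences n T k) \<and>
    of_int (signed_GT_enumeration n T k) =
      (det (binomial_mat n (\<lambda>i. of_int (k i + int i))) :: 'a::field_char_0)"
  using assms
proof (induction n arbitrary: k rule: nat_induct_at_least)
  case base
  then have "n_tree 1 (T 1)"
    by (simp add: tree_sequence_def)
  then have "GT_sign 1 T L = 1" for L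
    by (simp add: GT_sign_def GT_inversions_def tree_sequence_sign_def tree_sign_1[unfolded One_nat_def])
  \<comment> \<open>There is a single sequence, of sign 1, and the product formula for the
    determinant of order 1 is empty.\<close>
  then show ?case
    unfolding signed_GT_enumeration_def GT_tree_sequences_1 by (simp add: det_binomial_mat)
next
  case (Suc m)
  let ?T = "T (Suc m)"
  let ?I = "Pi\<^sub>E {1..<Suc m} (edge_interval ?T k)"
  let ?c = "tree_sign (Suc m) ?T * (-1) ^ card (inversions ?T k)"
  let ?f = "\<lambda>(l, L). L(Suc m := restrict k {1..Suc m})"
  have T: "tree_sequence m T" "n_tree (Suc m) ?T"
    using Suc.prems by (simp_all add: tree_sequence_Suc)
  have bij: "bij_betw ?f (SIGMA l:?I. GT_tree_sequences m T l) (GT_tree_sequences (Suc m) T k)"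
    using Suc.hyps T(2) by (rule GT_tree_sequences_bij_betw)
  have fin: "finite ?I" "\<And>l. finite (GT_tree_sequences m T l)"
    using Suc.IH[OF T(1)] by (auto intro: finite_PiE)
  then have "finite (GT_tree_sequences (Suc m) T k)"
    using bij_betw_finite[OF bij] by auto
  moreover have sign: "GT_sign (Suc m) T (L(Suc m := restrict k {1..Suc m})) = ?c * GT_sign m T L" for L
    using Suc.hyps Suc.prems by (rule GT_sign_Suc) simp
  have "signed_GT_enumeration (Suc m) T k =
      (\<Sum>(l, L)\<in>(SIGMA l:?I. GT_tree_sequences m T l). ?c * GT_sign m T L)"
    unfolding signed_GT_enumeration_def
    by (subst sum.reindex_bij_betw[OF bij, symmetric])
      (simp only: case_prod_unfold sign)
  then have "signed_GT_enumeration (Suc m) T k = ?c * (\<Sum>l\<in>?I. signed_GT_enumeration m T l)"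
    using fin by (simp add: sum.Sigma[symmetric] signed_GT_enumeration_def sum_distrib_left)
  then have "of_int (signed_GT_enumeration (Suc m) T k) =
      of_int (tree_sign (Suc m) ?T) * ((-1) ^ card (inversions ?T k) *
        (\<Sum>l\<in>?I. det (binomial_mat m (\<lambda>i. of_int (l i + int i)))) :: 'a)"
    using Suc.IH[OF T(1)] by (simp add: mult.assoc)
  then have "of_int (signed_GT_enumeration (Suc m) T k) =
      (det (binomial_mat (Suc m) (\<lambda>i. of_int (k i + int i))) :: 'a)"
    \<comment> \<open>Summation turns the determinants of order \<open>m\<close> into that of the
      edge differences, and the tree sign turns the latter into the binomial determinant of order
      \<open>Suc m\<close>.\<close>
    by (simp only: sum_admissible_det_binomial[OF T(2)] tree_sign_mult_det_binomial[OF T(2)])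
  ultimately show ?case
    by blast
qed

theorem theorem1:
  fixes n :: nat
    and T :: "nat \<Rightarrow> (nat, nat) pre_digraph"
    and k :: "nat \<Rightarrow> int"
  assumes "n \<ge> 1"
    and "tree_sequence n T"
  shows "(of_int (signed_GT_enumeration n T k) :: rat) =
    (\<Prod>(i, j)\<in>{(i, j). 1 \<le> i \<and> i < j \<and> j \<le> n}.
       of_int (k j - k i + int j - int i) / of_int (int j - int i))"
proof -
  let ?x = "\<lambda>i. of_int (k i + int i) :: rat"
  have "of_int (signed_GT_enumeration n T k) =
      (\<Prod>j<n. \<Prod>i<j. (?x (Suc j) - ?x (Suc i)) / (of_nat j - of_nat i))"
    using signed_GT_enumeration_eq_det[OF assms, where 'a = rat] by (simp only: det_binomial_mat)
  also have "\<dots> = (\<Prod>(j, i)\<in>(SIGMA j:{..<n}. {..<j}).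
      (?x (Suc j) - ?x (Suc i)) / (of_nat j - of_nat i))"
    by (rule prod.Sigma) auto
  \<comment> \<open>Both indices are raised by one, which leaves the denominators unchanged, and the
    pairs are swapped.\<close>
  also have "\<dots> = (\<Prod>(i, j)\<in>{(i, j). 1 \<le> i \<and> i < j \<and> j \<le> n}.
       of_int (k j - k i + int j - int i) / of_int (int j - int i))"
    by (rule prod.reindex_bij_witness[where j = "\<lambda>(j, i). (Suc i, Suc j)"
          and i = "\<lambda>(i, j). (j - 1, i - 1)"]) (auto simp: algebra_simps)
  finally show ?thesis .
qed

end
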